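(* Let $K\in\mathcal{B}(\mathcal{H}_n)$ and let $U$ be a unitary operator on $\mathcal{H}_n$ that commutes with $K$, i.e., $UK=KU$. Then a $K$-dual pair $(F,G)$ is $1$-erasure optimal with respect to the operator norm if and only if $(UF,UG)$ is a $1$-erasure optimal $K$-dual pair with respect to the operator norm.
   Context: $\mathcal{H}_n$ is an $n$-dimensional Hilbert space (over $\mathbb{R}$ or $\mathbb{C}$), $\mathcal{B}(\mathcal{H}_n)$ is the algebra of bounded linear operators on it, and $N$ is a fixed positive integer. For $K\in\mathcal{B}(\mathcal{H}_n)$, a sequence $F=\{f_i\}_{i=1}^N\subset\mathcal{H}_n$ is a $K$-frame if there are constants $0<A\le B<\infty$ with $A\|K^*f\|^2\le\sum_{i=1}^N|\langle f,f_i\rangle|^2\le B\|f\|^2$ for all $f\in\mathcal{H}_n$. A sequence $G=\{g_i\}_{i=1}^N\subset\mathcal{H}_n$ is a $K$-dual of the $K$-frame $F$ if $Kf=\sum_{i=1}^N\langle f,g_i\rangle f_i$ for all $f\in\mathcal{H}_n$ (equivalently $K^*f=\sum_{i=1}^N\langle f,f_i\rangle g_i$ for all $f$). In this case $(F,G)$ is called an $(N,n)$ $K$-dual pair for $\mathcal{H}_n$. For an operator $U$, $UF:=\{Uf_i\}_{i=1}^N$ and $UG:=\{Ug_i\}_{i=1}^N$. For a $K$-dual pair $(F,G)$, $\mathbb{O}_1(F,G)$ denotes the maximum over $1\le i\le N$ of the operator norm of the error operator $f\mapsto\langle f,f_i\rangle g_i$, i.e. $\mathbb{O}_1(F,G)=\max_{1\le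 i\le N}\|f_i\|\,\|g_i\|$. Set $\widetilde{\mathbb{O}}_1:=\inf\{\mathbb{O}_1(F,G):(F,G)\text{ is an }(N,n)\ K\text{-dual pair for }\mathcal{H}_n\}$. A $K$-dual pair $(F',G')$ is $1$-erasure optimal with respect to the operator norm if $\mathbb{O}_1(F',G')=\widetilde{\mathbb{O}}_1$. *)

theory Defs
  imports "HOL-Analysis.Analysis"
begin

text \<open>The scalar field is the field of real or of complex numbers. The class below has (up to
  isomorphism) only these two models, see \<open>real_or_complex\<close>.\<close>

class rc_field = real_normed_field +
  fixes cj :: "'a \<Rightarrow> 'a"
  assumes cj_add: "cj (x + y) = cj x + cj y"
    and cj_mult: "cj (x * y) = cj x * cj y"
    and mult_cj_scaleR: "x * cj x = (norm x)\<^sup>2 *\<^sub>R 1"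

instantiation real :: rc_field
begin
definition cj_real :: "real \<Rightarrow> real" where "cj_real x = x"
instance by standard (simp_all add: cj_real_def power2_eq_square)
end

instantiation complex :: rc_field
begin
definition cj_complex :: "complex \<Rightarrow> complex" where "cj_complex = cnj"
instance by standard (simp_all add: cj_complex_def complex_norm_square[symmetric] scaleR_conv_of_real)
end

lemma mult_cj: "x * cj x = (of_real ((norm x)\<^sup>2) :: 'k::rc_field)"
  using mult_cj_scaleR[of x] by (simp add: of_real_def)

lemma cj_of_real [simp]: "cj (of_real r) = (of_real r :: 'k::rc_field)"
proof (cases "r = 0")
  case True
  have "cj (0::'k) = 0" using cj_add[of "0::'k" 0] by simp
  with True show ?thesis by simp
next
  case False
  have "(of_real r :: 'k) * cj (of_real r) = of_real r * of_real r"
    using mult_cj[of "of_real r :: 'k"] by (simp add: power2_eq_square)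
  with False show ?thesis by simp
qed

lemma cj_minus: "cj (- x) = - cj (x :: 'k::rc_field)"
  using cj_mult[of "of_real (-1)" x] by (simp only: cj_of_real) simp

lemma cj_fixed_real:
  assumes "cj x = (x :: 'k::rc_field)"
  shows "\<exists>r. x = of_real r"
proof -
  have "x * x = of_real (norm x) * of_real (norm x)"
    using mult_cj[of x] assms by (simp add: power2_eq_square)
  then have "x = of_real (norm x) \<or> x = - of_real (norm x)"
    by (simp add: square_eq_iff)
  then show ?thesis by (metis of_real_minus)
qed

lemma cj_cj: "cj (cj x) = (x :: 'k::rc_field)"
proof (cases "x = 0")
  case True
  then show ?thesis using cj_of_real[of 0] by (metis of_real_0)
next
  case False
  have "cj x * cj (cj x) = cj x * x"
    using cj_mult[of x "cj x"] unfolding mult_cj cj_of_real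
    by (simp only: mult_cj[symmetric] mult.commute)
  moreover have "cj x \<noteq> 0" using mult_cj[of x] False by auto
  ultimately show ?thesis by simp
qed

lemma real_or_complex:
  "(\<forall>x::'k::rc_field. \<exists>a. x = of_real a) \<or>
   (\<exists>\<i>\<^sub>k::'k. \<i>\<^sub>k * \<i>\<^sub>k = -1 \<and> cj \<i>\<^sub>k = - \<i>\<^sub>k \<and> (\<forall>x. \<exists>a b. x = of_real a + of_real b * \<i>\<^sub>k))"
proof (cases "\<exists>y::'k. y \<noteq> 0 \<and> cj y = - y")
  case True
  then obtain y :: 'k where y: "y \<noteq> 0" "cj y = - y" by blast
  define j where "j = of_real (inverse (norm y)) * y"
  have cj_j: "cj j = - j" unfolding j_def by (simp only: cj_mult cj_of_real y) simp
  have "norm j = 1" unfolding j_def using y by (simp only: norm_mult norm_of_real) simp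
  then have jj: "j * j = -1" using mult_cj[of j] cj_j by (metis minus_mult_right minus_minus of_real_1 one_power2)
  have "\<exists>a b. x = of_real a + of_real b * j" for x
  proof -
    have "cj (x + cj x) = x + cj x" by (simp add: cj_add cj_cj add.commute)
    then obtain a where a: "x + cj x = of_real a" using cj_fixed_real by blast
    have cj_skew: "cj (x - cj x) = cj x - x"
      using cj_add[of x "- cj x"] by (simp add: cj_minus cj_cj)
    have "cj ((x - cj x) * j) = (x - cj x) * j"
      unfolding cj_mult cj_skew cj_j by (simp add: algebra_simps)
    then obtain b where b: "(x - cj x) * j = of_real b" using cj_fixed_real by blast
    have "x - cj x = - of_real b * j"
      using arg_cong[OF b, of "\<lambda>t. t * j"] jj by (simp add: mult.assoc) (metis minus_diff_eq)
    then have "(x - cj x) + (x + cj x) = of_real (- b) * j + of_real a" using a by simp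
    then have "x + x = of_real a + of_real (- b) * j" by (simp add: add.commute)
    then have "x = of_real (a / 2) + of_real (- b / 2) * j" by (simp add: field_simps)
    then show ?thesis by blast
  qed
  with jj cj_j show ?thesis by blast
next
  case False
  have "\<exists>a. x = of_real a" for x :: 'k
  proof -
    have "cj (x - cj x) = - (x - cj x)"
      using cj_add[of x "- cj x"] by (simp add: cj_minus cj_cj)
    with False have "x - cj x = 0" by blast
    then show ?thesis using cj_fixed_real[of x] by simp
  qed
  then show ?thesis by blast
qed

text \<open>The norm and the real scalar multiplication of the type class are tied to the
  inner product and to \<open>smul\<close>, so that the library's \<open>norm\<close>, \<open>bounded_linear\<close> and
  \<open>onorm\<close> are those of the Hilbert space. Inner products are linear in the first argument.\<close>

locale hilbert_space_dim = vector_space smul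
  for smul :: "'k::rc_field \<Rightarrow> 'a::banach \<Rightarrow> 'a" +
  fixes ip :: "'a \<Rightarrow> 'a \<Rightarrow> 'k"
    and n :: nat
  assumes smul_of_real: "smul (of_real r) x = r *\<^sub>R x"
    and ip_add_left: "ip (x + y) z = ip x z + ip y z"
    and ip_smul_left: "ip (smul c x) y = c * ip x y"
    and ip_commute: "ip y x = cj (ip x y)"
    and ip_self: "ip x x = of_real ((norm x)\<^sup>2)"
    and basis_card: "\<exists>B. finite B \<and> independent B \<and> span B = UNIV \<and> card B = n"

lemma hilbert_space_dim_euclidean:
  "hilbert_space_dim (scaleR :: real \<Rightarrow> 'a::euclidean_space \<Rightarrow> 'a) inner DIM('a)"
proof
  show "\<exists>B::'a set. finite B \<and> \<not> module.dependent scaleR B \<and> module.span scaleR B = UNIV \<and> card B = DIM('a)"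
    using independent_Basis span_Basis
    unfolding dependent_raw_def span_raw_def by (intro exI[of _ Basis]) simp
qed (simp_all add: cj_real_def algebra_simps inner_add_left inner_commute power2_norm_eq_inner)

lemma hilbert_space_dim_complex_vec:
  "hilbert_space_dim ((*s) :: complex \<Rightarrow> complex ^ 'n \<Rightarrow> _) (\<lambda>x y. \<Sum>i\<in>UNIV. x $ i * cnj (y $ i)) CARD('n)"
proof
  show "\<exists>B::(complex ^ 'n) set. finite B \<and> vec.independent B \<and> vec.span B = UNIV \<and> card B = CARD('n)"
    using vec.independent_Basis vec.span_Basis card_cart_basis finite_cart_basis by blast
  show "(\<Sum>i\<in>UNIV. x $ i * cnj (x $ i)) = complex_of_real ((norm x)\<^sup>2)" for x :: "complex ^ 'n"
    by (simp add: norm_vec_def L2_set_def sum_nonneg complex_norm_square[symmetric])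
qed (simp_all add: vec_eq_iff cj_complex_def algebra_simps sum.distrib sum_distrib_left
       scaleR_conv_of_real[where 'a = complex])

definition bounded_operator :: "('k::rc_field \<Rightarrow> 'a::banach \<Rightarrow> 'a) \<Rightarrow> ('a \<Rightarrow> 'a) \<Rightarrow> bool" where
  "bounded_operator smul T \<longleftrightarrow> Vector_Spaces.linear smul smul T \<and> bounded_linear T"

text \<open>In finite dimension every operator has a unique adjoint, which is then the function chosen
  here.\<close>

definition adj :: "('a \<Rightarrow> 'a \<Rightarrow> 'k::rc_field) \<Rightarrow> ('a \<Rightarrow> 'a) \<Rightarrow> 'a \<Rightarrow> 'a" where
  "adj ip T = (SOME S. \<forall>x y. ip (T x) y = ip x (S y))"

definition unitary_operator ::
    "('k::rc_field \<Rightarrow> 'a::banach \<Rightarrow> 'a) \<Rightarrow> ('a \<Rightarrow> 'a \<Rightarrow> 'k) \<Rightarrow> ('a \<Rightarrow> 'a) \<Rightarrow> bool" where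
  "unitary_operator smul ip U \<longleftrightarrow>
     bounded_operator smul U \<and> adj ip U \<circ> U = id \<and> U \<circ> adj ip U = id"

text \<open>Sequences of length \<open>N\<close> are functions on \<open>nat\<close> of which only the values at
  \<open>1, \<dots>, N\<close> matter.\<close>

definition K_frame ::
    "('a::banach \<Rightarrow> 'a \<Rightarrow> 'k::rc_field) \<Rightarrow> nat \<Rightarrow> ('a \<Rightarrow> 'a) \<Rightarrow> (nat \<Rightarrow> 'a) \<Rightarrow> bool" where
  "K_frame ip N K F \<longleftrightarrow>
     (\<exists>A B :: real. 0 < A \<and> A \<le> B \<and>
       (\<forall>f. A * (norm (adj ip K f))\<^sup>2 \<le> (\<Sum>i=1..N. (norm (ip f (F i)))\<^sup>2) \<and>
            (\<Sum>i=1..N. (norm (ip f (F i)))\<^sup>2) \<le> B * (norm f)\<^sup>2))"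

definition K_dual_pair ::
    "('k::rc_field \<Rightarrow> 'a::banach \<Rightarrow> 'a) \<Rightarrow> ('a \<Rightarrow> 'a \<Rightarrow> 'k) \<Rightarrow> nat \<Rightarrow> ('a \<Rightarrow> 'a)
      \<Rightarrow> (nat \<Rightarrow> 'a) \<Rightarrow> (nat \<Rightarrow> 'a) \<Rightarrow> bool" where
  "K_dual_pair smul ip N K F G \<longleftrightarrow>
     K_frame ip N K F \<and> (\<forall>f. K f = (\<Sum>i=1..N. smul (ip f (G i)) (F i)))"

definition erasure_error ::
    "('k::rc_field \<Rightarrow> 'a::banach \<Rightarrow> 'a) \<Rightarrow> ('a \<Rightarrow> 'a \<Rightarrow> 'k) \<Rightarrow> nat
      \<Rightarrow> (nat \<Rightarrow> 'a) \<Rightarrow> (nat \<Rightarrow> 'a) \<Rightarrow> real" where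
  "erasure_error smul ip N F G = (MAX i\<in>{1..N}. onorm (\<lambda>f. smul (ip f (F i)) (G i)))"

definition optimal_erasure_error ::
    "('k::rc_field \<Rightarrow> 'a::banach \<Rightarrow> 'a) \<Rightarrow> ('a \<Rightarrow> 'a \<Rightarrow> 'k) \<Rightarrow> nat \<Rightarrow> ('a \<Rightarrow> 'a) \<Rightarrow> real" where
  "optimal_erasure_error smul ip N K =
     Inf {erasure_error smul ip N F G | F G. K_dual_pair smul ip N K F G}"

definition one_erasure_optimal ::
    "('k::rc_field \<Rightarrow> 'a::banach \<Rightarrow> 'a) \<Rightarrow> ('a \<Rightarrow> 'a \<Rightarrow> 'k) \<Rightarrow> nat \<Rightarrow> ('a \<Rightarrow> 'a)
      \<Rightarrow> (nat \<Rightarrow> 'a) \<Rightarrow> (nat \<Rightarrow> 'a) \<Rightarrow> bool" where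
  "one_erasure_optimal smul ip N K F G \<longleftrightarrow>
     K_dual_pair smul ip N K F G \<and>
     erasure_error smul ip N F G = optimal_erasure_error smul ip N K"

end

theory Submission
  imports Defs
begin

text \<open>A unitary operator \<open>U\<close> that commutes with \<open>K\<close> maps \<open>K\<close>-dual pairs to \<open>K\<close>-dual pairs with the
  same erasure error. The optimal error depends only on \<open>K\<close>, so optimality is preserved in both
  directions.

  Both facts come from moving \<open>U\<close> to the other side of the inner product:
  \<open>ip f (U g) = ip (U\<^sup>* f) g\<close>. The reconstruction sum of the transformed pair is then
  \<open>U K U\<^sup>* = K\<close>; its frame sums are those of the original frame at \<open>U\<^sup>* f\<close>, where
  \<open>\<parallel>K\<^sup>* U\<^sup>* f\<parallel> = \<parallel>U\<^sup>* K\<^sup>* f\<parallel> = \<parallel>K\<^sup>* f\<parallel>\<close>; and each of its error operators is \<open>U T U\<^sup>*\<close> with \<open>T\<close> the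
  original one, which has the same norm because \<open>U\<close> and \<open>U\<^sup>*\<close> are surjective isometries.

  The function chosen by \<open>adj ip T\<close> is the adjoint only if an adjoint exists. In finite dimension
  an orthonormal basis \<open>E\<close> supplies one, \<open>T\<^sup>* y = (\<Sum>e\<in>E. ip y (T e) e)\<close>; hence the Gram--Schmidt
  argument leading to \<open>orthonormal_expansion\<close>, and from it \<open>ip_adj\<close>.\<close>

section \<open>Adjoints in finite dimension\<close>

context hilbert_space_dim
begin

lemma ip_zero_left [simp]: "ip 0 y = 0"
  using ip_add_left[of 0 0 y] by simp

lemma cj_zero: "cj (0::'k) = 0"
  using cj_of_real[of 0, where 'k='k] by simp

lemma ip_zero_right [simp]: "ip x 0 = 0"
  using ip_commute[of x 0] by (simp add: cj_zero)

lemma ip_add_right: "ip x (y + z) = ip x y + ip x z"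
  using ip_commute[of x "y + z"] ip_commute[of x y] ip_commute[of x z]
  by (simp add: ip_add_left cj_add)

lemma ip_smul_right: "ip x (smul c y) = cj c * ip x y"
  using ip_commute[of x "smul c y"] ip_commute[of x y] by (simp add: ip_smul_left cj_mult)

lemma ip_minus_left: "ip (- x) y = - ip x y"
  using ip_add_left[of "- x" x y] by (simp add: eq_neg_iff_add_eq_0)

lemma ip_diff_left: "ip (x - y) z = ip x z - ip y z"
  using ip_add_left[of x "- y" z] by (simp add: ip_minus_left)

lemma ip_sum_left: "ip (\<Sum>i\<in>I. h i) y = (\<Sum>i\<in>I. ip (h i) y)"
  by (induction I rule: infinite_finite_induct) (simp_all add: ip_add_left)

lemma ip_sum_right: "ip x (\<Sum>i\<in>I. h i) = (\<Sum>i\<in>I. ip x (h i))"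
  by (induction I rule: infinite_finite_induct) (simp_all add: ip_add_right)

lemma ip_eq_zero_commute: "ip x y = 0 \<Longrightarrow> ip y x = 0"
  by (metis ip_commute cj_zero)

lemma ip_self_eq_0: "ip x x = 0 \<longleftrightarrow> x = 0"
  unfolding ip_self of_real_eq_0_iff by simp

lemma ip_right_eqI:
  assumes "\<And>x. ip x y = ip x z"
  shows "y = z"
proof -
  have "ip (y - z) y = ip (y - z) z" using assms .
  then have "ip y (y - z) = ip z (y - z)" by (metis ip_commute)
  then have "ip (y - z) (y - z) = 0" by (simp add: ip_diff_left)
  then show ?thesis by (simp add: ip_self_eq_0)
qed

definition orthonormal :: "'a set \<Rightarrow> bool" where
  "orthonormal E \<longleftrightarrow> (\<forall>d\<in>E. \<forall>e\<in>E. ip d e = (if d = e then 1 else 0))"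

definition ortho_proj :: "'a set \<Rightarrow> 'a \<Rightarrow> 'a" where
  "ortho_proj E x = (\<Sum>e\<in>E. smul (ip x e) e)"

lemma subspace_ortho_proj_fixed: "subspace {x. ortho_proj E x = x}"
  by (rule subspaceI)
    (simp_all add: ortho_proj_def ip_add_left ip_smul_left scale_left_distrib sum.distrib
       scale_sum_right[symmetric] scale_scale[symmetric] del: scale_scale)

lemma ip_ortho_proj:
  assumes "finite E" "orthonormal E" "e \<in> E"
  shows "ip (ortho_proj E x) e = ip x e"
proof -
  have "ip (ortho_proj E x) e = (\<Sum>d\<in>E. if d = e then ip x d else 0)"
    unfolding ortho_proj_def ip_sum_left ip_smul_left
    using assms by (intro sum.cong) (auto simp: orthonormal_def)
  also have "\<dots> = ip x e" using assms by simp
  finally show ?thesis .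
qed

text \<open>One Gram--Schmidt step: the new unit vector is the normalised component of the new vector
  orthogonal to \<open>E\<close>.\<close>

lemma gram_schmidt:
  assumes "finite B"
  shows "\<exists>E. finite E \<and> orthonormal E \<and> (\<forall>b\<in>B. ortho_proj E b = b)"
  using assms
proof (induction B)
  case empty
  then show ?case by (intro exI[of _ "{}"]) (simp add: orthonormal_def)
next
  case (insert b B)
  then obtain E where E: "finite E" "orthonormal E" and B: "\<forall>b\<in>B. ortho_proj E b = b" by blast
  define w where "w = b - ortho_proj E b"
  show ?case
  proof (cases "w = 0")
    case True
    with E B show ?thesis by (intro exI[of _ E]) (simp add: w_def)
  next
    case False
    define c :: 'k where "c = of_real (inverse (norm w))"
    define u where "u = smul c w"
    have "ip w e = 0" if "e \<in> E" for e
      using ip_ortho_proj[OF E that] by (simp add: w_def ip_diff_left)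
    then have ue: "ip u e = 0" if "e \<in> E" for e
      using that by (simp add: u_def ip_smul_left)
    then have eu: "ip e u = 0" if "e \<in> E" for e
      using that ip_eq_zero_commute by blast
    have cj_c: "cj c = c" unfolding c_def by (rule cj_of_real)
    have "ip u u = c * (c * ip w w)" by (simp only: u_def ip_smul_left ip_smul_right cj_c)
    also have "\<dots> = 1" using False by (simp add: c_def ip_self power2_eq_square field_simps)
    finally have uu: "ip u u = 1" .
    have uE: "u \<notin> E" using ue uu by fastforce
    have onb: "orthonormal (insert u E)"
      using E(2) ue eu uu uE by (auto simp: orthonormal_def)
    have proj: "ortho_proj (insert u E) x = ortho_proj E x + smul (ip x u) u" for x
      using E(1) uE by (simp add: ortho_proj_def add.commute)
    have pu: "ip (ortho_proj E x) u = 0" for x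
      unfolding ortho_proj_def ip_sum_left ip_smul_left using eu by simp
    have "ortho_proj (insert u E) x = x" if "x \<in> B" for x
      using proj[of x] pu[of x] B that by simp
    moreover have "ortho_proj (insert u E) b = b"
    proof -
      have "ip b u = ip w u" using pu[of b] by (simp add: w_def ip_diff_left)
      also have "\<dots> = of_real (norm w)"
        using False by (simp add: u_def ip_smul_right cj_c) (simp add: c_def ip_self power2_eq_square)
      finally have "smul (ip b u) u = w" using False by (simp add: u_def c_def)
      then show ?thesis by (simp add: proj w_def)
    qed
    ultimately show ?thesis using E(1) onb by (intro exI[of _ "insert u E"]) auto
  qed
qed

lemma orthonormal_expansion: "\<exists>E. finite E \<and> (\<forall>x. (\<Sum>e\<in>E. smul (ip x e) e) = x)"
proof -
  obtain B where B: "finite B" "span B = UNIV" using basis_card by blast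
  obtain E where E: "finite E" "\<forall>b\<in>B. ortho_proj E b = b" using gram_schmidt[OF B(1)] by blast
  have "span B \<subseteq> {x. ortho_proj E x = x}"
    using E(2) by (intro span_minimal subspace_ortho_proj_fixed) auto
  then show ?thesis using E(1) B(2) unfolding ortho_proj_def by blast
qed

text \<open>Adjoints are unique, so exhibiting one identifies the choice made in \<open>adj\<close>.\<close>

lemma adj_eqI:
  assumes "\<And>x y. ip (T x) y = ip x (S y)"
  shows "adj ip T = S"
proof -
  have "\<forall>x y. ip (T x) y = ip x (adj ip T y)"
    unfolding adj_def
    by (rule someI[where P = "\<lambda>S. \<forall>x y. ip (T x) y = ip x (S y)" and x = S]) (use assms in blast)
  then show ?thesis using assms by (intro ext ip_right_eqI) metis
qed

lemma ip_adj:
  assumes "Vector_Spaces.linear smul smul T"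
  shows "ip (T x) y = ip x (adj ip T y)"
proof -
  interpret T: Vector_Spaces.linear smul smul T by fact
  obtain E where E: "\<And>x. (\<Sum>e\<in>E. smul (ip x e) e) = x"
    using orthonormal_expansion by blast
  define S where "S y = (\<Sum>e\<in>E. smul (ip y (T e)) e)" for y
  have S: "ip (T x) y = ip x (S y)" for x y
  proof -
    have "ip (T x) y = ip (T (\<Sum>e\<in>E. smul (ip x e) e)) y" by (simp only: E)
    also have "\<dots> = (\<Sum>e\<in>E. ip x e * ip (T e) y)"
      by (simp add: T.sum T.scale ip_sum_left ip_smul_left)
    also have "\<dots> = ip x (S y)"
      by (simp add: S_def ip_sum_right ip_smul_right ip_commute[symmetric] mult.commute)
    finally show ?thesis .
  qed
  then have "adj ip T = S" by (rule adj_eqI)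
  with S show ?thesis by simp
qed

section \<open>Unitary images of dual pairs\<close>

context
  fixes U :: "'a \<Rightarrow> 'a"
  assumes U: "unitary_operator smul ip U"
begin

lemma unitary_linear: "Vector_Spaces.linear smul smul U"
  using U by (simp add: unitary_operator_def bounded_operator_def)

lemma adj_unitary_cancel: "adj ip U (U x) = x" and unitary_adj_cancel: "U (adj ip U x) = x"
  using U by (simp_all add: unitary_operator_def fun_eq_iff)

text \<open>This identity reduces statements about \<open>U F\<close> and \<open>U G\<close> to ones about \<open>F\<close> and \<open>G\<close>: it trades \<open>U\<close> on the frame vectors for \<open>U\<^sup>*\<close> on the
  argument.\<close>

lemma ip_unitary_right: "ip x (U y) = ip (adj ip U x) y"
  using ip_adj[OF unitary_linear, of "adj ip U x" "U y"]
  by (simp add: adj_unitary_cancel unitary_adj_cancel)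

lemma norm_unitary: "norm (U x) = norm x"
proof -
  have "of_real ((norm (U x))\<^sup>2) = (of_real ((norm x)\<^sup>2) :: 'k)"
    by (simp only: ip_self[symmetric] ip_unitary_right adj_unitary_cancel)
  then have "(norm (U x))\<^sup>2 = (norm x)\<^sup>2" by (simp only: of_real_eq_iff)
  then show ?thesis by simp
qed

lemma norm_adj_unitary: "norm (adj ip U x) = norm x"
  using norm_unitary[of "adj ip U x"] by (simp add: unitary_adj_cancel)

text \<open>The substitution \<open>x \<mapsto> U\<^sup>* x\<close> permutes the quotients whose supremum is the operator norm, so
  \<open>T\<close> may be any function.\<close>

lemma onorm_unitary_conj: "onorm (\<lambda>x. U (T (adj ip U x))) = onorm T"
proof -
  have surj: "surj (adj ip U)" by (rule surjI[of _ U]) (rule adj_unitary_cancel)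
  have "range (\<lambda>x. norm (U (T (adj ip U x))) / norm x) =
      (\<lambda>x. norm (T x) / norm x) ` range (adj ip U)"
    by (simp add: image_image norm_unitary norm_adj_unitary)
  then show ?thesis by (simp add: onorm_def surj)
qed

lemma rank_one_unitary:
  "smul (ip f (U x)) (U y) = U (smul (ip (adj ip U f) x) y)"
proof -
  interpret U: Vector_Spaces.linear smul smul U by (rule unitary_linear)
  show ?thesis by (simp add: ip_unitary_right U.scale)
qed

lemma erasure_error_unitary:
  "erasure_error smul ip N (\<lambda>i. U (F i)) (\<lambda>i. U (G i)) = erasure_error smul ip N F G"
proof -
  have "onorm (\<lambda>f. smul (ip f (U (F i))) (U (G i))) = onorm (\<lambda>f. smul (ip f (F i)) (G i))" for i
    unfolding rank_one_unitary by (rule onorm_unitary_conj)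
  then show ?thesis by (simp add: erasure_error_def)
qed

lemma K_dual_pair_unitary:
  assumes K_linear: "Vector_Spaces.linear smul smul K"
    and comm: "U \<circ> K = K \<circ> U"
    and dual: "K_dual_pair smul ip N K F G"
  shows "K_dual_pair smul ip N K (\<lambda>i. U (F i)) (\<lambda>i. U (G i))"
proof -
  interpret U: Vector_Spaces.linear smul smul U by (rule unitary_linear)
  have K: "K x = (\<Sum>i=1..N. smul (ip x (G i)) (F i))" for x
    using dual by (simp add: K_dual_pair_def)
  have sum_eq: "(\<Sum>i=1..N. smul (ip f (U (G i))) (U (F i))) = K f" for f
  proof -
    have "(\<Sum>i=1..N. smul (ip f (U (G i))) (U (F i))) = U (K (adj ip U f))"
      by (simp only: rank_one_unitary U.sum K)
    also have "\<dots> = K (U (adj ip U f))" using comm by (simp add: fun_eq_iff)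
    finally show ?thesis by (simp add: unitary_adj_cancel)
  qed
  \<comment> \<open>Take adjoints in \<open>K = U K U\<^sup>*\<close>.\<close>
  have "adj ip K = (\<lambda>f. U (adj ip K (adj ip U f)))"
  proof (rule adj_eqI)
    fix x f
    have "K x = U (K (adj ip U x))"
      using comm unitary_adj_cancel[of x] by (metis comp_apply)
    then show "ip (K x) f = ip x (U (adj ip K (adj ip U f)))"
      by (simp add: ip_adj[OF unitary_linear] ip_adj[OF K_linear] ip_unitary_right)
  qed
  then have norm_eq: "norm (adj ip K (adj ip U f)) = norm (adj ip K f)" for f
    by (metis norm_unitary)
  obtain A B where "0 < A" "A \<le> B"
    and frame: "\<And>f. A * (norm (adj ip K f))\<^sup>2 \<le> (\<Sum>i=1..N. (norm (ip f (F i)))\<^sup>2) \<and>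
            (\<Sum>i=1..N. (norm (ip f (F i)))\<^sup>2) \<le> B * (norm f)\<^sup>2"
    using dual unfolding K_dual_pair_def K_frame_def by blast
  then have "K_frame ip N K (\<lambda>i. U (F i))"
    unfolding K_frame_def ip_unitary_right
    using frame[of "adj ip U _", unfolded norm_eq norm_adj_unitary] by blast
  with sum_eq show ?thesis by (simp add: K_dual_pair_def)
qed

end

end

theorem mainTheorem3:
  fixes smul :: "'k::rc_field \<Rightarrow> 'a::banach \<Rightarrow> 'a"
    and ip :: "'a \<Rightarrow> 'a \<Rightarrow> 'k"
    and n N :: nat
    and K U :: "'a \<Rightarrow> 'a"
    and F G :: "nat \<Rightarrow> 'a"
  assumes "hilbert_space_dim smul ip n"
    and "N > 0"
    and "bounded_operator smul K"
    and "unitary_operator smul ip U"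
    and "U \<circ> K = K \<circ> U"
    and "K_dual_pair smul ip N K F G"
  shows "one_erasure_optimal smul ip N K F G \<longleftrightarrow>
         one_erasure_optimal smul ip N K (\<lambda>i. U (F i)) (\<lambda>i. U (G i))"
proof -
  interpret hilbert_space_dim smul ip n by fact
  have "Vector_Spaces.linear smul smul K" using assms(3) by (simp add: bounded_operator_def)
  then show ?thesis
    using assms(6) K_dual_pair_unitary[OF assms(4) _ assms(5,6)] erasure_error_unitary[OF assms(4)]
    by (simp add: one_erasure_optimal_def)
qed

end
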